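(* Let $c = c_1 + c_2 \mathbf{i_2} \in \mathbb{BC}$ with $c_1,c_2\in\mathbb{C}(\mathbf{i_1})$. The bicomplex Julia set corresponding to $c$ may be expressed as $$\mathcal{J}_{2,c} = ( \mathcal{J}_{c_1 - c_2 \mathbf{i_1}} \times_e \mathcal{K}_{c_1 + c_2 \mathbf{i_1}} ) \cup ( \mathcal{K}_{c_1 - c_2 \mathbf{i_1}} \times_e \mathcal{J}_{c_1 + c_2 \mathbf{i_1}} ),$$ where $\mathcal{J}_{c_1 - c_2 \mathbf{i_1}} \times_e \mathcal{J}_{c_1 + c_2 \mathbf{i_1}}\subseteq \mathcal{J}_{2,c}$.
   Context: The bicomplex numbers are $\mathbb{BC}=\{z_1+z_2\mathbf{i_2} \mid z_1,z_2\in\mathbb{C}(\mathbf{i_1})\}$, where $\mathbb{C}(\mathbf{i_1})=\{x+y\mathbf{i_1}\mid x,y\in\mathbb{R}\}$ is the field of complex numbers with imaginary unit $\mathbf{i_1}$; $\mathbf{i_1}^2=\mathbf{i_2}^2=-1$, $\mathbf{i_1}\mathbf{i_2}=\mathbf{i_2}\mathbf{i_1}=\mathbf{j}$, $\mathbf{j}^2=1$. This is a commutative unitary ring, with norm $\|z_1+z_2\mathbf{i_2}\|=\sqrt{|z_1|^2+|z_2|^2}$ and the corresponding (Euclidean) topology. Put $\mathbf{e_1}=\frac{1+\mathbf{j}}{2}$, $\mathbf{e_2}=\frac{1-\mathbf{j}}{2}$; every bicomplex number is uniquely written $z_1+z_2\mathbf{i_2}=(z_1-z_2\mathbf{i_1})\mathbf{e_1}+(z_1+z_2\mathbf{i_1})\mathbf{e_2}$,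 and addition and multiplication are componentwise in this representation. For nonempty $X_1,X_2\subseteq\mathbb{C}(\mathbf{i_1})$, $X_1\times_e X_2:=\{w_1\mathbf{e_1}+w_2\mathbf{e_2}\mid w_1\in X_1,\ w_2\in X_2\}\subseteq\mathbb{BC}$. For $a\in\mathbb{C}(\mathbf{i_1})$ and $P_a(z)=z^2+a$ on $\mathbb{C}(\mathbf{i_1})$, with $P_a^n$ denoting the $n$-th iterate, the filled-in Julia set is $\mathcal{K}_a=\{z\in\mathbb{C}(\mathbf{i_1})\mid \{P_a^n(z)\}_{n=0}^\infty \text{ is bounded}\}$ and the Julia set is its boundary $\mathcal{J}_a=\partial\mathcal{K}_a$ in $\mathbb{C}(\mathbf{i_1})$. For $c\in\mathbb{BC}$ and $P_c(w)=w^2+c$ on $\mathbb{BC}$, the bicomplex filled-in Julia set is $\mathcal{K}_{2,c}=\{w\in\mathbb{BC}\mid \{P_c^n(w)\}_{n=0}^\infty\text{ is bounded}\}$ and the bicomplex Julia set is its boundary $\mathcal{J}_{2,c}=\partial\mathcal{K}_{2,c}$ in $\mathbb{BC}$. *)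

theory Defs
  imports "HOL-Analysis.Analysis"
begin

section \<open>Bicomplex numbers\<close>

text \<open>
  The field of complex numbers with imaginary unit \<open>i\<^sub>1\<close> is the library type \<^typ>\<open>complex\<close>,
  with \<open>i\<^sub>1\<close> being \<^const>\<open>imaginary_unit\<close>. The value \<open>Bicomplex z\<^sub>1 z\<^sub>2\<close> stands for
  \<open>z\<^sub>1 + z\<^sub>2 i\<^sub>2\<close>.
\<close>

codatatype bicomplex = Bicomplex (bc1: complex) (bc2: complex)

lemma bicomplex_eq_iff: "x = y \<longleftrightarrow> bc1 x = bc1 y \<and> bc2 x = bc2 y"
  by (auto intro: bicomplex.expand)

lemma bicomplex_eqI: "bc1 x = bc1 y \<Longrightarrow> bc2 x = bc2 y \<Longrightarrow> x = y"
  by (simp add: bicomplex_eq_iff)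

instantiation bicomplex :: comm_ring_1
begin

primcorec zero_bicomplex where
  "bc1 0 = 0"
| "bc2 0 = 0"

primcorec one_bicomplex where
  "bc1 1 = 1"
| "bc2 1 = 0"

primcorec plus_bicomplex where
  "bc1 (x + y) = bc1 x + bc1 y"
| "bc2 (x + y) = bc2 x + bc2 y"

primcorec uminus_bicomplex where
  "bc1 (- x) = - bc1 x"
| "bc2 (- x) = - bc2 x"

primcorec minus_bicomplex where
  "bc1 (x - y) = bc1 x - bc1 y"
| "bc2 (x - y) = bc2 x - bc2 y"

primcorec times_bicomplex where
  "bc1 (x * y) = bc1 x * bc1 y - bc2 x * bc2 y"
| "bc2 (x * y) = bc1 x * bc2 y + bc2 x * bc1 y"

instance
  by standard (simp_all add: bicomplex_eq_iff algebra_simps)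

end

instantiation bicomplex :: real_algebra_1
begin

primcorec scaleR_bicomplex where
  "bc1 (scaleR r x) = r *\<^sub>R bc1 x"
| "bc2 (scaleR r x) = r *\<^sub>R bc2 x"

instance
  by standard (simp_all add: bicomplex_eq_iff algebra_simps)

end

text \<open>
  The norm is not submultiplicative, so this type is not an instance of
  \<^class>\<open>real_normed_algebra\<close>.
\<close>

instantiation bicomplex :: real_normed_vector
begin

definition norm_bicomplex_def: "norm x = sqrt ((cmod (bc1 x))\<^sup>2 + (cmod (bc2 x))\<^sup>2)"

definition sgn_bicomplex_def: "sgn x = x /\<^sub>R norm x" for x :: bicomplex

definition dist_bicomplex_def: "dist x y = norm (x - y)" for x y :: bicomplex

definition uniformity_bicomplex_def:
  "(uniformity :: (bicomplex \<times> bicomplex) filter) = (INF e\<in>{0 <..}. principal {(x, y). dist x y < e})"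

definition open_bicomplex_def:
  "open U \<longleftrightarrow> (\<forall>x\<in>U. eventually (\<lambda>(x', y). x' = x \<longrightarrow> y \<in> U) uniformity)"
  for U :: "bicomplex set"

instance
proof
  fix r :: real and x y :: bicomplex and U :: "bicomplex set"
  have norm_eq: "norm z = norm (bc1 z, bc2 z)" for z :: bicomplex
    by (simp add: norm_bicomplex_def norm_prod_def)
  show "norm x = 0 \<longleftrightarrow> x = 0"
    by (simp add: norm_eq bicomplex_eq_iff zero_prod_def[symmetric] prod_eq_iff)
  show "norm (x + y) \<le> norm x + norm y"
    using norm_triangle_ineq[of "(bc1 x, bc2 x)" "(bc1 y, bc2 y)"] by (simp add: norm_eq)
  show "norm (r *\<^sub>R x) = \<bar>r\<bar> * norm x"
    using norm_scaleR[of r "(bc1 x, bc2 x)"] by (simp add: norm_eq)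
qed (simp_all add: bicomplex_eq_iff algebra_simps sgn_bicomplex_def dist_bicomplex_def
      uniformity_bicomplex_def open_bicomplex_def)

end

primcorec bc_of_complex :: "complex \<Rightarrow> bicomplex" where
  "bc1 (bc_of_complex z) = z"
| "bc2 (bc_of_complex z) = 0"

primcorec bc_i2 :: bicomplex where
  "bc1 bc_i2 = 0"
| "bc2 bc_i2 = 1"

definition bc_j :: bicomplex
  where "bc_j = bc_of_complex \<i> * bc_i2"

definition bc_e1 :: bicomplex
  where "bc_e1 = (1 / 2) *\<^sub>R (1 + bc_j)"

definition bc_e2 :: bicomplex
  where "bc_e2 = (1 / 2) *\<^sub>R (1 - bc_j)"

lemma Bicomplex_eq: "Bicomplex z1 z2 = bc_of_complex z1 + bc_of_complex z2 * bc_i2"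
  by (simp add: bicomplex_eq_iff)

lemma bc_i2_squared: "bc_i2 * bc_i2 = - 1"
  by (simp add: bicomplex_eq_iff)

lemma bc_j_squared: "bc_j * bc_j = 1"
  by (simp add: bicomplex_eq_iff bc_j_def)

lemma bc_idempotent_representation:
  "bc_of_complex z1 + bc_of_complex z2 * bc_i2 =
     bc_of_complex (z1 - z2 * \<i>) * bc_e1 + bc_of_complex (z1 + z2 * \<i>) * bc_e2"
  by (simp add: bicomplex_eq_iff bc_e1_def bc_e2_def bc_j_def complex_eq_iff field_simps)


section \<open>The product set along the idempotents\<close>

definition bc_times_e :: "complex set \<Rightarrow> complex set \<Rightarrow> bicomplex set"  (infixr "\<times>\<^sub>e" 80)
  where "X1 \<times>\<^sub>e X2 = {bc_of_complex w1 * bc_e1 + bc_of_complex w2 * bc_e2 | w1 w2. w1 \<in> X1 \<and> w2 \<in> X2}"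


section \<open>Filled-in Julia sets and Julia sets\<close>

text \<open>
  These are stated once for \<^typ>\<open>complex\<close> and \<^typ>\<open>bicomplex\<close>.
\<close>

definition quad_map :: "'a::comm_ring_1 \<Rightarrow> 'a \<Rightarrow> 'a"
  where "quad_map c w = w\<^sup>2 + c"

definition filled_julia :: "'a::{comm_ring_1, real_normed_vector} \<Rightarrow> 'a set"
  where "filled_julia c = {w. bounded (range (\<lambda>n. (quad_map c ^^ n) w))}"

definition julia :: "'a::{comm_ring_1, real_normed_vector} \<Rightarrow> 'a set"
  where "julia c = frontier (filled_julia c)"

end

theory Submission
  imports Defs
begin

text \<open>
  Up to the factor \<open>sqrt 2\<close>, the idempotent representation is an isometric ring isomorphism
  from \<open>\<complex> \<times> \<complex>\<close> onto the bicomplex numbers. It therefore conjugates \<open>quad_map c\<close> with a pair of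
  complex quadratic maps, so the filled-in Julia set is a product, and the Julia set is the
  frontier of this product. Filled-in Julia sets of complex quadratic polynomials are closed,
  because an orbit is bounded iff it never leaves the disc of radius \<open>2 + |a|\<close>.
\<close>

definition bc_idem :: "complex \<times> complex \<Rightarrow> bicomplex"
  where "bc_idem p = bc_of_complex (fst p) * bc_e1 + bc_of_complex (snd p) * bc_e2"

text \<open>The inverse of \<open>bc_idem\<close>: the coefficients of \<open>bc_e1\<close> and
  \<open>bc_e2\<close>.\<close>

definition bc_coords :: "bicomplex \<Rightarrow> complex \<times> complex"
  where "bc_coords w = (bc1 w - bc2 w * \<i>, bc1 w + bc2 w * \<i>)"

lemma bc_times_e_eq_image: "X1 \<times>\<^sub>e X2 = bc_idem ` (X1 \<times> X2)"
  by (force simp: bc_times_e_def bc_idem_def image_iff)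

lemma bc1_bc_idem: "bc1 (bc_idem p) = (fst p + snd p) / 2"
  by (simp add: bc_idem_def bc_e1_def bc_e2_def bc_j_def complex_eq_iff field_simps)

lemma bc2_bc_idem: "bc2 (bc_idem p) = \<i> * (fst p - snd p) / 2"
  by (simp add: bc_idem_def bc_e1_def bc_e2_def bc_j_def complex_eq_iff field_simps)

lemma bc_coords_bc_idem [simp]: "bc_coords (bc_idem p) = p"
  by (simp add: bc_coords_def bc1_bc_idem bc2_bc_idem prod_eq_iff complex_eq_iff field_simps)

lemma bc_idem_bc_coords [simp]: "bc_idem (bc_coords w) = w"
  by (simp add: bc_coords_def bc1_bc_idem bc2_bc_idem bicomplex_eq_iff complex_eq_iff)

lemma linear_bc_idem: "linear bc_idem"
  by (rule linearI)
    (simp_all add: bicomplex_eq_iff complex_eq_iff bc1_bc_idem bc2_bc_idem field_simps)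

lemma norm_bc_idem: "norm (bc_idem p) = norm p / sqrt 2"
proof -
  \<comment> \<open>Parallelogram law.\<close>
  have "(cmod (fst p + snd p) / 2)\<^sup>2 + (cmod (fst p - snd p) / 2)\<^sup>2
      = ((cmod (fst p))\<^sup>2 + (cmod (snd p))\<^sup>2) / 2"
    by (simp add: cmod_power2 power_divide) (simp add: power2_eq_square field_simps)
  then show ?thesis
    by (simp add: norm_bicomplex_def norm_prod_def bc1_bc_idem bc2_bc_idem norm_mult norm_divide
        flip: real_sqrt_divide)
qed

text \<open>Distances scale by exactly \<open>1 / sqrt 2\<close>, so \<open>bc_idem\<close> and its
  inverse \<open>bc_coords\<close> are both Lipschitz. The form with \<open>homeomorphic_map\<close>
  is the one that transports frontiers.\<close>

lemma homeomorphic_map_bc_idem: "homeomorphic_map euclidean euclidean bc_idem"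
proof -
  have "dist (bc_idem p) (bc_idem q) = dist p q / sqrt 2" for p q
    by (simp add: dist_norm norm_bc_idem flip: linear_diff [OF linear_bc_idem])
  then have dist_coords: "dist (bc_coords v) (bc_coords w) = sqrt 2 * dist v w" for v w
    by (metis bc_idem_bc_coords nonzero_mult_div_cancel_left times_divide_eq_right
        real_sqrt_eq_zero_cancel_iff zero_neq_numeral)
  have "bounded_linear bc_idem"
    using linear_bc_idem by (intro bounded_linear_intro [where K = "1 / sqrt 2"])
      (simp_all add: linear_add linear_scale norm_bc_idem)
  then have "continuous_on UNIV bc_idem"
    by (rule linear_continuous_on)
  moreover have "continuous_on UNIV bc_coords"
    by (rule lipschitz_on_continuous_on [where L = "sqrt 2"], rule lipschitz_onI)
      (simp_all add: dist_coords)
  ultimately have "homeomorphic_maps euclidean euclidean bc_idem bc_coords"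
    by (simp add: homeomorphic_maps_def)
  then show ?thesis
    by (rule homeomorphic_maps_imp_map)
qed

lemma frontier_bc_times_e: "frontier (X1 \<times>\<^sub>e X2) = bc_idem ` frontier (X1 \<times> X2)"
  using homeomorphic_map_frontier_of [OF homeomorphic_map_bc_idem, of "X1 \<times> X2"]
  by (simp add: bc_times_e_eq_image)

text \<open>\<open>bc_e1\<close> and \<open>bc_e2\<close> are orthogonal idempotents with sum 1, so
  squaring and adding the parameter act on each coefficient separately.\<close>

lemma quad_map_bc_idem:
  "quad_map (bc_idem (a, b)) (bc_idem (u, v)) = bc_idem (quad_map a u, quad_map b v)"
  by (simp add: bicomplex_eq_iff quad_map_def power2_eq_square bc1_bc_idem bc2_bc_idem
      field_simps)

lemma quad_map_funpow_bc_idem: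
  "(quad_map (bc_idem (a, b)) ^^ n) (bc_idem (u, v))
     = bc_idem ((quad_map a ^^ n) u, (quad_map b ^^ n) v)"
  by (induction n) (simp_all add: quad_map_bc_idem)

lemma filled_julia_bc_idem:
  "filled_julia (bc_idem (a, b)) = filled_julia a \<times>\<^sub>e filled_julia b"
proof -
  have bdd_pair: "bounded (range (\<lambda>n. bc_idem (f n, g n))) \<longleftrightarrow> bounded (range f) \<and> bounded (range g)"
    for f g :: "nat \<Rightarrow> complex"
  proof
    assume "bounded (range (\<lambda>n. bc_idem (f n, g n)))"
    \<comment> \<open>The factor \<open>sqrt 2\<close> undoes the scaling in
      \<open>norm_bc_idem\<close>.\<close>
    then obtain B where B: "norm (f n, g n) \<le> B * sqrt 2" for n
      by (auto simp: bounded_iff norm_bc_idem field_simps)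
    show "bounded (range f) \<and> bounded (range g)"
      unfolding bounded_iff
      using B norm_fst_le norm_snd_le by (blast intro: order_trans)
  next
    assume "bounded (range f) \<and> bounded (range g)"
    then have "bounded (range f \<times> range g)"
      by (simp add: bounded_Times)
    then obtain B where B: "norm (f n, g n) \<le> B" for n
      by (fastforce simp: bounded_iff)
    show "bounded (range (\<lambda>n. bc_idem (f n, g n)))"
      unfolding bounded_iff
      using B by (auto simp: norm_bc_idem intro!: exI [of _ "B / sqrt 2"] divide_right_mono)
  qed
  have "bc_idem (u, v) \<in> filled_julia (bc_idem (a, b)) \<longleftrightarrow> u \<in> filled_julia a \<and> v \<in> filled_julia b"
    for u v
    by (simp add: filled_julia_def quad_map_funpow_bc_idem bdd_pair)
  \<comment> \<open>Bijectivity of \<open>bc_idem\<close> turns the pointwise equivalence into an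
    equality of sets.\<close>
  moreover have "\<exists>u v. w = bc_idem (u, v)" for w
    by (metis bc_idem_bc_coords surj_pair)
  moreover have "inj bc_idem"
    by (metis bc_coords_bc_idem injI)
  ultimately show ?thesis
    by (auto simp: bc_times_e_eq_image image_iff dest: injD) (metis SigmaI)
qed

text \<open>With r = |z|, the modulus of z^2 + a is at least r^2 - |a| \<ge> 2r + r|a| - |a| \<ge>
  2r \<ge> r + 1. A constant gain per step already forces escape.\<close>

lemma norm_quad_map_ge:
  fixes a z :: complex
  assumes "norm z \<ge> 2 + norm a"
  shows "norm (quad_map a z) \<ge> norm z + 1"
proof -
  have "norm z * 2 + norm z * norm a \<le> norm z * norm z"
    using mult_left_mono [OF assms, of "norm z"] by (simp add: distrib_left)
  moreover have "1 * norm a \<le> norm z * norm a"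
    using assms norm_ge_zero [of a] by (intro mult_right_mono) linarith+
  moreover have "norm z * norm z - norm a \<le> norm (quad_map a z)"
    using norm_diff_ineq [of "z\<^sup>2" a] by (simp add: quad_map_def power2_eq_square norm_mult)
  ultimately show ?thesis
    using assms norm_ge_zero [of a] by linarith
qed

text \<open>Since the modulus never drops, every iterate stays in the region where the one-step
  estimate applies.\<close>

lemma norm_funpow_quad_map_ge:
  fixes a z :: complex
  assumes "norm z \<ge> 2 + norm a"
  shows "norm ((quad_map a ^^ n) z) \<ge> norm z + n"
proof (induction n)
  case (Suc n)
  then show ?case
    using norm_quad_map_ge [of a "(quad_map a ^^ n) z"] assms by simp
qed simp

text \<open>One radius serves for all orbits, because an orbit that leaves this disc grows without
  bound. As an intersection of preimages of closed discs, the set is visibly closed.\<close>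

lemma filled_julia_complex_eq:
  fixes a :: complex
  shows "filled_julia a = (\<Inter>n. (quad_map a ^^ n) -` cball 0 (2 + norm a))"
proof (intro equalityI subsetI)
  fix z assume "z \<in> filled_julia a"
  then obtain B where B: "norm ((quad_map a ^^ n) z) \<le> B" for n
    by (auto simp: filled_julia_def bounded_iff)
  have "norm ((quad_map a ^^ n) z) \<le> 2 + norm a" for n
  proof (rule ccontr)
    assume "\<not> ?thesis"
    then have large: "norm ((quad_map a ^^ n) z) \<ge> 2 + norm a" by simp
    \<comment> \<open>Restarting from the n-th iterate, m further steps push the modulus past the
      bound B.\<close>
    obtain m :: nat where "B < m"
      using reals_Archimedean2 by blast
    moreover have "norm ((quad_map a ^^ (m + n)) z) \<ge> m"
      using norm_funpow_quad_map_ge [OF large, of m] norm_ge_zero [of "(quad_map a ^^ n) z"]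
      unfolding funpow_add o_apply by linarith
    ultimately show False
      using B [of "m + n"] by simp
  qed
  then show "z \<in> (\<Inter>n. (quad_map a ^^ n) -` cball 0 (2 + norm a))"
    by simp
next
  fix z assume "z \<in> (\<Inter>n. (quad_map a ^^ n) -` cball 0 (2 + norm a))"
  then show "z \<in> filled_julia a"
    by (auto simp: filled_julia_def bounded_iff)
qed

lemma continuous_on_funpow_quad_map:
  fixes a :: complex
  shows "continuous_on UNIV (quad_map a ^^ n)"
proof (induction n)
  case (Suc n)
  have "continuous_on S (quad_map a)" for S
    unfolding quad_map_def by (intro continuous_intros)
  then show ?case
    using Suc unfolding funpow.simps by (intro continuous_on_compose)
qed (simp add: continuous_on_id')

lemma closed_filled_julia:
  fixes a :: complex
  shows "closed (filled_julia a)"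
  unfolding filled_julia_complex_eq
  by (intro closed_INT ballI closed_vimage closed_cball continuous_on_funpow_quad_map)

theorem corollary1:
  fixes c :: bicomplex and c1 c2 :: complex
  assumes "c = bc_of_complex c1 + bc_of_complex c2 * bc_i2"
  shows "julia c =
           (julia (c1 - c2 * \<i>) \<times>\<^sub>e filled_julia (c1 + c2 * \<i>)) \<union>
           (filled_julia (c1 - c2 * \<i>) \<times>\<^sub>e julia (c1 + c2 * \<i>))
         \<and> julia (c1 - c2 * \<i>) \<times>\<^sub>e julia (c1 + c2 * \<i>) \<subseteq> julia c"
proof -
  let ?a = "c1 - c2 * \<i>" and ?b = "c1 + c2 * \<i>"
  have c: "c = bc_idem (?a, ?b)"
    unfolding assms bc_idem_def fst_conv snd_conv by (rule bc_idempotent_representation)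
  have closed: "closure (filled_julia ?a) = filled_julia ?a"
      "closure (filled_julia ?b) = filled_julia ?b"
    by (simp_all add: closed_filled_julia)
  have julia_subset: "julia z \<subseteq> filled_julia z" for z :: complex
    unfolding julia_def by (rule frontier_subset_closed [OF closed_filled_julia])
  have "frontier (filled_julia ?a \<times> filled_julia ?b)
      = julia ?a \<times> filled_julia ?b \<union> filled_julia ?a \<times> julia ?b"
    \<comment> \<open>A point of the product of the two closed sets lies outside the product of
      their interiors iff one of its coordinates is not interior.\<close>
    unfolding julia_def frontier_def closure_Times interior_Times closed by auto
  moreover have "julia c = bc_idem ` frontier (filled_julia ?a \<times> filled_julia ?b)"
    by (simp only: julia_def [of "bc_idem _"] c filled_julia_bc_idem frontier_bc_times_e)
  ultimately have "julia c = (julia ?a \<times>\<^sub>e filled_julia ?b) \<union> (filled_julia ?a \<times>\<^sub>e julia ?b)"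
    by (simp only: bc_times_e_eq_image image_Un)
  \<comment> \<open>Enlarging the second factor places the product of Julia sets in the first piece
    of the union.\<close>
  moreover have "julia ?a \<times>\<^sub>e julia ?b \<subseteq> julia ?a \<times>\<^sub>e filled_julia ?b"
    unfolding bc_times_e_eq_image using julia_subset by (intro image_mono Sigma_mono) auto
  ultimately show ?thesis
    by blast
qed

end
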